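(* Let $\{X_i, i\ge 1\}$ be independent and identically distributed random variables with $P\{X_1=0\}=P\{X_1=1\}=\frac12$, and let $M_N$ be the number of switches of the longest run of consecutive switches in $(X_1,\dots,X_N)$. Let $\varepsilon$ be any positive number. Then for almost all $\omega\in\Omega$ there exists an infinite sequence $N_i=N_i(\omega,\varepsilon)$ $(i=1,2,\dots)$ of (distinct) integers such that $$M_{N_i}<\left[\log N_i-\log\log\log N_i+\log\log e+\varepsilon\right].$$
   Context: All random variables are defined on a probability space $(\Omega,\mathcal F,P)$. The symbol $\log$ denotes the logarithm with base $2$, $e$ is the base of the natural logarithm, and $[x]$ is the largest integer which is no more than $x$; the integers $N_i$ are understood to be large enough ($N_i\ge 3$) for the iterated logarithm to be defined. For integers $m,n\ge 1$ let $$S_n^{(m)}=\sum_{i=m+1}^{n+m-1}(1-X_{i-1})X_i+\sum_{i=m+1}^{n+m-1}X_{i-1}(1-X_i),$$ which is the total number of switches (indices $i$ with $X_{i-1}\neq X_i$) in the block $(X_m,\dots,X_{m+n-1})$ (an empty sum is $0$, so $S_1^{(m)}=0$). For integers $i,N\ge 1$ and $1\le n\le N$ let $H_{n,i}^{(N)}=\bigcup_{i\le m\le i+N-n}\{S_n^{(m)}=n-1\}$, the event that some block of $n$ consecutive terms of $(X_i,\dots,X_{i+N-1})$ consists entirely of switches. Define the random variable $M_N^{(i)}(\omega)=\max\{n-1: 1\le n\le N,\ \omega\in H_{n,i}^{(N)}\}$ and $M_N=M_N^{(1)}$. *)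

theory Defs
  imports "HOL-Probability.Probability"
begin

text \<open>
  The sequence \<open>X\<close> is indexed from 1; the value \<open>X 0\<close> is never used (for \<open>m \<ge> 1\<close>).
\<close>

definition switch_count :: "(nat \<Rightarrow> 'a \<Rightarrow> real) \<Rightarrow> nat \<Rightarrow> nat \<Rightarrow> 'a \<Rightarrow> real" where
  "switch_count X n m \<omega> =
     (\<Sum>i = m + 1..n + m - 1. (1 - X (i - 1) \<omega>) * X i \<omega>) +
     (\<Sum>i = m + 1..n + m - 1. X (i - 1) \<omega> * (1 - X i \<omega>))"

text \<open>Used only for \<open>1 \<le> n \<le> N\<close>, so that the natural subtraction \<open>i + N - n\<close> is exact.\<close>

definition switch_run_event ::
    "'a measure \<Rightarrow> (nat \<Rightarrow> 'a \<Rightarrow> real) \<Rightarrow> nat \<Rightarrow> nat \<Rightarrow> nat \<Rightarrow> 'a set" where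
  "switch_run_event M X N n i =
     (\<Union>m\<in>{i..i + N - n}. {\<omega> \<in> space M. switch_count X n m \<omega> = real n - 1})"

definition longest_switch_run_from ::
    "'a measure \<Rightarrow> (nat \<Rightarrow> 'a \<Rightarrow> real) \<Rightarrow> nat \<Rightarrow> nat \<Rightarrow> 'a \<Rightarrow> nat" where
  "longest_switch_run_from M X i N \<omega> =
     Max {n - 1 | n. 1 \<le> n \<and> n \<le> N \<and> \<omega> \<in> switch_run_event M X N n i}"

abbreviation longest_switch_run ::
    "'a measure \<Rightarrow> (nat \<Rightarrow> 'a \<Rightarrow> real) \<Rightarrow> nat \<Rightarrow> 'a \<Rightarrow> nat" where
  "longest_switch_run M X \<equiv> longest_switch_run_from M X 1"

text \<open>The maximum is taken over a finite nonempty set: \<open>n = 1\<close> always qualifies.\<close>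

lemma finite_switch_runs:
  "finite {n - 1 | n. 1 \<le> n \<and> n \<le> N \<and> \<omega> \<in> switch_run_event M X N n i}"
  by simp

lemma switch_runs_nonempty:
  assumes "1 \<le> N" and "\<omega> \<in> space M"
  shows "{n - 1 | n. 1 \<le> n \<and> n \<le> N \<and> \<omega> \<in> switch_run_event M X N n i} \<noteq> {}"
proof -
  have "\<omega> \<in> switch_run_event M X N 1 i"
    using assms by (auto simp: switch_run_event_def switch_count_def intro: bexI[of _ i])
  with assms show ?thesis by blast
qed

end

theory Submission
  imports Defs "HOL-Real_Asymp.Real_Asymp"
begin

text \<open>
  Switches are independent fair bits. Sample at \<open>N(K) = \<lfloor>2\<^bsup>K - \<epsilon>/2\<^esup> ln K\<rfloor>\<close>, chosen so that for large \<open>K\<close>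
  the bound in the theorem is at least \<open>K\<close>. The probability is at least
  \<open>(1 - 2\<^bsup>-K\<^esup>)\<^bsup>N\<^esup> \<ge> K\<^bsup>-d\<^esup>\<close>, for some \<open>d < 1\<close>, that \<open>N\<close> terms contain no run of \<open>K\<close> switches.
  Along \<open>K\<^sub>j = \<lceil>3 j log j\<rceil>\<close> these probabilities are not summable, so by the second Borel-Cantelli lemma
  infinitely many of the disjoint blocks \<open>(N(K\<^sub>j\<^sub>-\<^sub>1), N(K\<^sub>j)]\<close> contain no run of length \<open>K\<^sub>j\<close>. Runs starting
  before the block have total probability at most \<open>N(K\<^sub>j\<^sub>-\<^sub>1) 2\<^bsup>-K\<^sub>j\<^esup> \<le> j\<^bsup>-2\<^esup>\<close>, so they occur only
  finitely often.
\<close>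

section \<open>The second Borel-Cantelli lemma\<close>

text \<open>By the product rule for the complements, the probability that \<open>P k\<close> fails
  for all k \<ge> n is at most a product of factors \<open>1 - p k\<close>, hence at most exp of
  minus a partial sum of the tail. Divergence makes this arbitrarily small.\<close>

lemma (in prob_space) borel_cantelli2_AE:
  fixes P :: "nat \<Rightarrow> 'a \<Rightarrow> bool"
  assumes indep: "indep_events (\<lambda>n. {x \<in> space M. \<not> P n x}) UNIV"
    and nsum: "\<not> summable (\<lambda>n. prob {x \<in> space M. P n x})"
  shows "AE x in M. infinite {n. P n x}"
proof -
  define p where "p n = prob {x \<in> space M. P n x}" for n
  have [measurable]: "{x \<in> space M. \<not> P n x} \<in> events" for n
    using indep by (auto simp: indep_events_def)
  have prob_neg: "prob {x \<in> space M. \<not> P n x} = 1 - p n" for n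
    using prob_neg[of "\<lambda>x. \<not> P n x"] by (simp add: p_def)
  have p: "0 \<le> p n" "p n \<le> 1" for n by (auto simp: p_def)
  have zero: "prob {x \<in> space M. \<forall>k\<ge>n. \<not> P k x} = 0" for n
  proof -
    \<comment> \<open>\<open>Suc m\<close> keeps the index set nonempty, as the product rule in
      \<open>indep_events_def\<close> requires.\<close>
    have bound: "prob {x \<in> space M. \<forall>k\<ge>n. \<not> P k x} \<le> exp (- (\<Sum>k\<in>{n..<n + Suc m}. p k))" for m
    proof -
      have "prob {x \<in> space M. \<forall>k\<ge>n. \<not> P k x} \<le> prob (\<Inter>k\<in>{n..<n + Suc m}. {x \<in> space M. \<not> P k x})"
        by (intro finite_measure_mono) auto
      also have "\<dots> = (\<Prod>k\<in>{n..<n + Suc m}. prob {x \<in> space M. \<not> P k x})"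
        using indep unfolding indep_events_def by (auto simp del: sum.op_ivl_Suc prod.op_ivl_Suc)
      also have "\<dots> \<le> (\<Prod>k\<in>{n..<n + Suc m}. exp (- p k))"
        using p exp_ge_add_one_self[of "- p _"] by (intro prod_mono) (auto simp: prob_neg)
      also have "\<dots> = exp (- (\<Sum>k\<in>{n..<n + Suc m}. p k))"
        by (simp add: exp_sum sum_negf[symmetric] del: sum.op_ivl_Suc)
      finally show ?thesis .
    qed
    \<comment> \<open>Divergence survives dropping the first \<open>n\<close> terms.\<close>
    have unbounded: "\<exists>m. (\<Sum>k\<in>{n..<n + Suc m}. p k) > B" for B
    proof (rule ccontr)
      assume "\<not> ?thesis"
      then have *: "(\<Sum>k\<in>{n..<n + Suc m}. p k) \<le> B" for m by (simp add: not_less)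
      have "summable (\<lambda>k. p (k + n))"
      proof (rule bounded_imp_summable)
        show "(\<Sum>k\<le>m. p (k + n)) \<le> B" for m
          using *[of m] sum.shift_bounds_nat_ivl[of p 0 n "Suc m"]
          by (simp add: add.commute atLeast0LessThan lessThan_Suc_atMost del: sum.op_ivl_Suc)
      qed (use p in auto)
      then have "summable p" by (simp only: summable_iff_shift)
      then show False using nsum by (simp add: p_def[abs_def])
    qed
    show ?thesis
    proof (rule ccontr)
      assume "prob {x \<in> space M. \<forall>k\<ge>n. \<not> P k x} \<noteq> 0"
      then have pos: "prob {x \<in> space M. \<forall>k\<ge>n. \<not> P k x} > 0" by (simp add: zero_less_measure_iff)
      \<comment> \<open>A partial sum beyond minus the logarithm of the probability pushes the bound
        below that probability.\<close>
      obtain m where "(\<Sum>k\<in>{n..<n + Suc m}. p k) > - ln (prob {x \<in> space M. \<forall>k\<ge>n. \<not> P k x})"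
        using unbounded by blast
      then have "exp (- (\<Sum>k\<in>{n..<n + Suc m}. p k)) < exp (ln (prob {x \<in> space M. \<forall>k\<ge>n. \<not> P k x}))"
        by (subst exp_less_cancel_iff) linarith
      with bound[of m] pos show False by simp
    qed
  qed
  have "AE x in M. \<not> (\<forall>k\<ge>n. \<not> P k x)" for n
    using zero[of n] by (subst (asm) prob_eq_0) auto
  then have "AE x in M. \<forall>n. \<not> (\<forall>k\<ge>n. \<not> P k x)" by (simp add: AE_all_countable)
  then show ?thesis
    by (rule AE_mp) (auto simp: infinite_nat_iff_unbounded_le)
qed

section \<open>Predicates on blocks of coordinates, and switch runs\<close>

text \<open>Predicates live on total sequences, so those with different index sets combine directly.
  Invariance under \<open>restrict\<close> makes them factor through the product space over
  \<open>I\<close>, where independence of disjoint blocks applies.\<close>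

definition depends_on :: "nat set \<Rightarrow> ((nat \<Rightarrow> real) \<Rightarrow> bool) \<Rightarrow> bool" where
  "depends_on I Q \<longleftrightarrow> Measurable.pred (PiM I (\<lambda>_. borel)) Q \<and> (\<forall>x. Q (restrict x I) = Q x)"

lemma depends_on_mono:
  assumes "depends_on I Q" "I \<subseteq> J"
  shows "depends_on J Q"
proof -
  have r: "Q (restrict x I) = Q x" for x using assms(1) by (simp add: depends_on_def)
  have "Measurable.pred (PiM I (\<lambda>_. borel)) Q" using assms(1) by (simp add: depends_on_def)
  then have "Measurable.pred (PiM J (\<lambda>_. borel)) (\<lambda>x. Q (restrict x I))"
    by (rule measurable_compose[OF measurable_restrict_subset[OF assms(2)]])
  moreover have "Q (restrict x J) = Q x" for x
    using r[of "restrict x J"] r[of x] assms(2) by (simp add: Int_absorb1)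
  ultimately show ?thesis by (simp add: depends_on_def r)
qed

lemma depends_on_not: "depends_on I Q \<Longrightarrow> depends_on I (\<lambda>x. \<not> Q x)"
  by (auto simp: depends_on_def)

lemma depends_on_conj: "depends_on I Q \<Longrightarrow> depends_on I R \<Longrightarrow> depends_on I (\<lambda>x. Q x \<and> R x)"
  by (auto simp: depends_on_def)

lemma depends_on_imp: "(c \<Longrightarrow> depends_on I Q) \<Longrightarrow> depends_on I (\<lambda>x. c \<longrightarrow> Q x)"
  by (cases c) (auto simp: depends_on_def)

lemma depends_on_all:
  fixes Q :: "nat \<Rightarrow> (nat \<Rightarrow> real) \<Rightarrow> bool"
  shows "(\<And>a. depends_on I (Q a)) \<Longrightarrow> depends_on I (\<lambda>x. \<forall>a. Q a x)"
  unfolding depends_on_def by (auto intro!: pred_intros_countable)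

lemma depends_on_eq: "i \<in> I \<Longrightarrow> depends_on I (\<lambda>x. x i = b)"
  unfolding depends_on_def by (auto intro!: pred_eq_const1[where N=borel])

text \<open>The values 0 and 1 are spelled out so that a switch splits into two disjoint cases, each
  fixing the later bit, before the null set of other values is discarded.\<close>

definition switch_at :: "(nat \<Rightarrow> real) \<Rightarrow> nat \<Rightarrow> bool" where
  "switch_at x i \<longleftrightarrow> x (i - 1) = 0 \<and> x i = 1 \<or> x (i - 1) = 1 \<and> x i = 0"

text \<open>\<open>a\<close> is the term just before the first switch, so \<open>K\<close> switches
  occupy the \<open>K + 1\<close> terms from \<open>a\<close> to \<open>a + K\<close>.\<close>

definition switch_run :: "nat \<Rightarrow> nat \<Rightarrow> (nat \<Rightarrow> real) \<Rightarrow> bool" where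
  "switch_run a K x \<longleftrightarrow> (\<forall>i. a < i \<and> i \<le> a + K \<longrightarrow> switch_at x i)"

definition no_switch_run :: "nat \<Rightarrow> nat \<Rightarrow> nat \<Rightarrow> (nat \<Rightarrow> real) \<Rightarrow> bool" where
  "no_switch_run m n K x \<longleftrightarrow> (\<forall>a. m \<le> a \<and> a + K \<le> n \<longrightarrow> \<not> switch_run a K x)"

lemma depends_on_switch_at:
  assumes "i - 1 \<in> I" "i \<in> I" shows "depends_on I (\<lambda>x. switch_at x i)"
proof -
  \<comment> \<open>De Morgan form, matching the closure rules for negation and conjunction.\<close>
  have "depends_on I (\<lambda>x. \<not> (\<not> (x (i - 1) = 0 \<and> x i = 1) \<and> \<not> (x (i - 1) = 1 \<and> x i = 0)))"
    using assms by (intro depends_on_not depends_on_conj depends_on_eq)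
  then show ?thesis by (simp add: switch_at_def)
qed

lemma depends_on_switch_run: "{a..a + K} \<subseteq> I \<Longrightarrow> depends_on I (switch_run a K)"
  unfolding switch_run_def[abs_def]
  by (intro depends_on_all depends_on_imp depends_on_switch_at) (auto intro!: subsetD[of "{a..a + K}" I])

lemma depends_on_no_switch_run: "depends_on {m..n} (no_switch_run m n K)"
  unfolding no_switch_run_def[abs_def]
  by (intro depends_on_all depends_on_imp depends_on_not depends_on_switch_run) auto

section \<open>Probabilities of switch runs in fair bits\<close>

locale fair_bits = prob_space M for M :: "'a measure" +
  fixes X :: "nat \<Rightarrow> 'a \<Rightarrow> real"
  assumes indep: "indep_vars (\<lambda>_. borel) X {1..}"
    and fair: "\<And>i b. 1 \<le> i \<Longrightarrow> b \<in> {0, 1} \<Longrightarrow> prob {\<omega> \<in> space M. X i \<omega> = b} = 1 / 2"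
begin

definition pr :: "((nat \<Rightarrow> real) \<Rightarrow> bool) \<Rightarrow> real" where
  "pr Q = prob {\<omega> \<in> space M. Q (\<lambda>i. X i \<omega>)}"

lemma event_depends_on:
  assumes "depends_on I Q" "I \<subseteq> {1..}"
  shows "{\<omega> \<in> space M. Q (\<lambda>i. X i \<omega>)} \<in> events"
proof -
  have [measurable]: "Measurable.pred (PiM I (\<lambda>_. borel)) Q" using assms(1) by (simp add: depends_on_def)
  have [measurable]: "(\<lambda>\<omega>. restrict (\<lambda>i. X i \<omega>) I) \<in> measurable M (PiM I (\<lambda>_. borel))"
    using indep assms(2) by (auto simp: indep_vars_def intro!: measurable_restrict)
  have E: "{\<omega> \<in> space M. Q (restrict (\<lambda>i. X i \<omega>) I)} \<in> events" by measurable
  have "Q (restrict (\<lambda>i. X i \<omega>) I) = Q (\<lambda>i. X i \<omega>)" for \<omega>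
    using assms(1) by (simp add: depends_on_def)
  with E show ?thesis by (simp only:)
qed

lemma pr_mono:
  assumes "depends_on I R" "I \<subseteq> {1..}" "\<And>x. Q x \<Longrightarrow> R x"
  shows "pr Q \<le> pr R"
  unfolding pr_def using assms by (intro finite_measure_mono event_depends_on) auto

lemma pr_disj:
  assumes "depends_on I Q" "depends_on I R" "I \<subseteq> {1..}" "\<And>x. \<not> (Q x \<and> R x)"
  shows "pr (\<lambda>x. Q x \<or> R x) = pr Q + pr R"
proof -
  have "{\<omega> \<in> space M. Q (\<lambda>i. X i \<omega>) \<or> R (\<lambda>i. X i \<omega>)} = {\<omega> \<in> space M. Q (\<lambda>i. X i \<omega>)} \<union> {\<omega> \<in> space M. R (\<lambda>i. X i \<omega>)}"
    by auto
  then show ?thesis unfolding pr_def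
    using assms by (simp only:) (intro finite_measure_Union event_depends_on; auto)
qed

lemma indep_events_depends_on:
  fixes I :: "nat \<Rightarrow> nat set"
  assumes Q: "\<And>j. depends_on (I j) (Q j)" and I: "\<And>j. I j \<subseteq> {1..}" "disjoint_family I"
  shows "indep_events (\<lambda>j. {\<omega> \<in> space M. Q j (\<lambda>i. X i \<omega>)}) UNIV"
proof -
  have "indep_vars (\<lambda>j. PiM (I j) (\<lambda>_. borel)) (\<lambda>j \<omega>. restrict (\<lambda>i. X i \<omega>) (I j)) UNIV"
    by (rule indep_vars_restrict[OF indep]) (use I in auto)
  then have "indep_events (\<lambda>j. {\<omega> \<in> space M. Q j (restrict (\<lambda>i. X i \<omega>) (I j))}) UNIV"
    by (rule indep_eventsI_indep_vars) (use Q in \<open>simp add: depends_on_def pred_def\<close>)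
  then show ?thesis using Q by (simp add: depends_on_def)
qed

lemma pr_conj_indep:
  assumes Q: "depends_on I Q" and R: "depends_on J R"
    and IJ: "I \<inter> J = {}" "I \<subseteq> {1..}" "J \<subseteq> {1..}"
  shows "pr (\<lambda>x. Q x \<and> R x) = pr Q * pr R"
proof -
  let ?S = "\<lambda>I Q. {x \<in> space (PiM I (\<lambda>_. borel)). Q x} :: (nat \<Rightarrow> real) set"
  have "indep_var (PiM I (\<lambda>_. borel)) (\<lambda>\<omega>. restrict (\<lambda>i. X i \<omega>) I)
          (PiM J (\<lambda>_. borel)) (\<lambda>\<omega>. restrict (\<lambda>i. X i \<omega>) J)"
    by (rule indep_var_restrict[OF indep IJ])
  from indep_varD[OF this, of "?S I Q" "?S J R"]
  have "prob ((\<lambda>\<omega>. (restrict (\<lambda>i. X i \<omega>) I, restrict (\<lambda>i. X i \<omega>) J)) -` (?S I Q \<times> ?S J R) \<inter> space M) =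
      prob ((\<lambda>\<omega>. restrict (\<lambda>i. X i \<omega>) I) -` ?S I Q \<inter> space M) *
      prob ((\<lambda>\<omega>. restrict (\<lambda>i. X i \<omega>) J) -` ?S J R \<inter> space M)"
    using Q R by (simp add: depends_on_def pred_def)
  moreover have "(\<lambda>\<omega>. restrict (\<lambda>i. X i \<omega>) I) -` ?S I Q \<inter> space M = {\<omega> \<in> space M. Q (\<lambda>i. X i \<omega>)}"
      "(\<lambda>\<omega>. restrict (\<lambda>i. X i \<omega>) J) -` ?S J R \<inter> space M = {\<omega> \<in> space M. R (\<lambda>i. X i \<omega>)}"
      "(\<lambda>\<omega>. (restrict (\<lambda>i. X i \<omega>) I, restrict (\<lambda>i. X i \<omega>) J)) -` (?S I Q \<times> ?S J R) \<inter> space M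
        = {\<omega> \<in> space M. Q (\<lambda>i. X i \<omega>) \<and> R (\<lambda>i. X i \<omega>)}"
    using Q R by (auto simp: depends_on_def space_PiM)
  ultimately show ?thesis by (simp only: pr_def)
qed

text \<open>Given the bit at \<open>a\<close>, a switch at \<open>Suc a\<close> asks for the
  opposite value of a fresh bit, independent of the terms up to \<open>a\<close>. Only an inequality
  is claimed, since \<open>x a\<close> is not yet confined to 0 and 1.\<close>

lemma pr_conj_switch_at:
  assumes Q: "depends_on {m..a} Q" and m: "1 \<le> m" "m \<le> a"
  shows "pr (\<lambda>x. Q x \<and> switch_at x (Suc a)) \<le> pr Q / 2"
proof -
  have half: "pr (\<lambda>x. (Q x \<and> x a = b) \<and> x (Suc a) = b') = pr (\<lambda>x. Q x \<and> x a = b) / 2"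
    if "b' \<in> {0, 1}" for b b'
  proof -
    have "pr (\<lambda>x. (Q x \<and> x a = b) \<and> x (Suc a) = b') = pr (\<lambda>x. Q x \<and> x a = b) * pr (\<lambda>x. x (Suc a) = b')"
      using m by (intro pr_conj_indep[of "{m..a}" _ "{Suc a}"] depends_on_conj Q depends_on_eq) auto
    also have "pr (\<lambda>x. x (Suc a) = b') = 1 / 2" using fair[of "Suc a" b'] that by (simp add: pr_def)
    finally show ?thesis by simp
  qed
  have Q': "depends_on {m..Suc a} Q" using Q by (rule depends_on_mono) auto
  have eq: "(\<lambda>x. Q x \<and> switch_at x (Suc a)) =
      (\<lambda>x. (Q x \<and> x a = 0) \<and> x (Suc a) = 1 \<or> (Q x \<and> x a = 1) \<and> x (Suc a) = 0)"
    by (auto simp: switch_at_def)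
  have "pr (\<lambda>x. Q x \<and> switch_at x (Suc a)) =
      pr (\<lambda>x. (Q x \<and> x a = 0) \<and> x (Suc a) = 1) + pr (\<lambda>x. (Q x \<and> x a = 1) \<and> x (Suc a) = 0)"
    unfolding eq using m
    by (intro pr_disj[of "{m..Suc a}"] depends_on_conj Q' depends_on_eq) auto
  also have "\<dots> = (pr (\<lambda>x. Q x \<and> x a = 0) + pr (\<lambda>x. Q x \<and> x a = 1)) / 2"
    using half[of 1 0] half[of 0 1] by simp
  also have "pr (\<lambda>x. Q x \<and> x a = 0) + pr (\<lambda>x. Q x \<and> x a = 1) = pr (\<lambda>x. Q x \<and> x a = 0 \<or> Q x \<and> x a = 1)"
    using m by (intro pr_disj[of "{m..a}", symmetric] depends_on_conj Q depends_on_eq) auto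
  also have "\<dots> \<le> pr Q" using m by (intro pr_mono[OF Q]) auto
  finally show ?thesis by simp
qed

lemma pr_conj_switch_run:
  assumes Q: "depends_on {m..a} Q" and m: "1 \<le> m" "m \<le> a"
  shows "pr (\<lambda>x. Q x \<and> switch_run a K x) \<le> pr Q / 2 ^ K"
proof (induction K)
  case 0
  have "switch_run a 0 x" for x by (auto simp: switch_run_def)
  then show ?case by simp
next
  case (Suc K)
  \<comment> \<open>The last switch is split off; what precedes it depends only on terms up to
    \<open>a + K\<close>.\<close>
  have "(\<lambda>x. Q x \<and> switch_run a (Suc K) x) = (\<lambda>x. (Q x \<and> switch_run a K x) \<and> switch_at x (Suc (a + K)))"
    by (auto simp: switch_run_def le_Suc_eq fun_eq_iff)
  then have "pr (\<lambda>x. Q x \<and> switch_run a (Suc K) x) =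
      pr (\<lambda>x. (Q x \<and> switch_run a K x) \<and> switch_at x (Suc (a + K)))" by (rule arg_cong)
  also have "\<dots> \<le> pr (\<lambda>x. Q x \<and> switch_run a K x) / 2"
    using m by (intro pr_conj_switch_at[of m] depends_on_conj depends_on_mono[OF Q] depends_on_switch_run) auto
  also have "\<dots> \<le> pr Q / 2 ^ Suc K" using Suc by simp
  finally show ?case .
qed

text \<open>
  A run completed at \<open>n + 1\<close> is the first one only if it is preceded by a non-switch at its start \<open>a\<close>.
  The event \<open>G\<close> of no earlier run up to \<open>a - 1\<close> and no switch at \<open>a\<close> already excludes all runs up to \<open>n\<close>
  and depends only on the terms up to \<open>a\<close>, whence the factor \<open>2\<^bsup>-K\<^esup>\<close>.
\<close>
lemma pr_no_switch_run_Suc: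
  assumes "1 \<le> m" "1 \<le> K"
  shows "pr (no_switch_run m n K) * (1 - 1 / 2 ^ K) \<le> pr (no_switch_run m (Suc n) K)"
proof (cases "m + K \<le> Suc n")
  case False
  \<comment> \<open>The block is too short for a run of \<open>K\<close> switches, so the new term
    changes nothing.\<close>
  then have "no_switch_run m (Suc n) K = no_switch_run m n K"
    by (auto simp: no_switch_run_def fun_eq_iff)
  then show ?thesis by (simp add: pr_def mult_left_le)
next
  case True
  define a where "a = Suc n - K"
  have a: "m \<le> a" "a + K = Suc n" "1 \<le> a" using True assms by (auto simp: a_def)
  \<comment> \<open>The guard covers \<open>a = m\<close>: there a switch at \<open>a\<close> would
    involve the term \<open>m - 1\<close> outside the block, and no earlier start is
    admissible.\<close>
  define G where "G x \<longleftrightarrow> no_switch_run m (a - 1) K x \<and> (m < a \<longrightarrow> \<not> switch_at x a)" for x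
  have G: "depends_on {m..a} G"
    unfolding G_def[abs_def]
    by (intro depends_on_conj depends_on_imp depends_on_not depends_on_switch_at
        depends_on_mono[OF depends_on_no_switch_run]) auto
  have G_imp: "no_switch_run m n K x" if "G x" for x
    unfolding no_switch_run_def
  proof (intro allI impI notI)
    fix b assume b: "m \<le> b \<and> b + K \<le> n" "switch_run b K x"
    have "b < a" using b a by linarith
    show False
    proof (cases "a \<le> b + K")
      case True
      with b \<open>b < a\<close> have "switch_at x a" "m < a" by (auto simp: switch_run_def)
      with that show False by (simp add: G_def)
    next
      case False
      with b that show False by (auto simp: G_def no_switch_run_def)
    qed
  qed
  \<comment> \<open>A switch at \<open>a\<close> would prolong the run backwards to one starting at
    \<open>a - 1\<close> and already completed at \<open>n\<close>.\<close>
  have imp_G: "G x" if "no_switch_run m n K x" "switch_run a K x" for x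
    unfolding G_def
  proof (intro conjI impI notI)
    show "no_switch_run m (a - 1) K x" using that(1) a assms by (auto simp: no_switch_run_def)
    assume ma: "m < a" and sw: "switch_at x a"
    have "switch_run (a - 1) K x"
      unfolding switch_run_def
    proof (intro allI impI)
      fix i assume i: "a - 1 < i \<and> i \<le> a - 1 + K"
      show "switch_at x i"
      proof (cases "i = a")
        case False
        then have "a < i \<and> i \<le> a + K" using i by linarith
        then show ?thesis using that(2) by (auto simp: switch_run_def)
      qed (use sw in simp)
    qed
    moreover have "m \<le> a - 1" "a - 1 + K \<le> n" using ma a by auto
    ultimately show False using that(1) by (auto simp: no_switch_run_def)
  qed
  have dep: "depends_on {m..Suc n} (no_switch_run m k K)" if "k \<le> Suc n" for k
    by (rule depends_on_mono[OF depends_on_no_switch_run]) (use that in auto)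
  have depr: "depends_on {m..Suc n} (switch_run a K)" by (rule depends_on_switch_run) (use a in auto)
  have "pr (no_switch_run m n K) = pr (\<lambda>x. no_switch_run m (Suc n) K x \<or> no_switch_run m n K x \<and> switch_run a K x)"
  proof (rule arg_cong[where f=pr], rule ext)
    fix x
    show "no_switch_run m n K x = (no_switch_run m (Suc n) K x \<or> no_switch_run m n K x \<and> switch_run a K x)"
    proof -
      have "b + K = Suc n \<longleftrightarrow> b = a" for b using a(2) by auto
      then show ?thesis using a(1) by (auto simp: no_switch_run_def le_Suc_eq)
    qed
  qed
  also have "\<dots> = pr (no_switch_run m (Suc n) K) + pr (\<lambda>x. no_switch_run m n K x \<and> switch_run a K x)"
    using a assms by (intro pr_disj[of "{m..Suc n}"] depends_on_conj dep depr) (auto simp: no_switch_run_def)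
  finally have split: "pr (no_switch_run m n K) =
      pr (no_switch_run m (Suc n) K) + pr (\<lambda>x. no_switch_run m n K x \<and> switch_run a K x)" .
  have "pr (\<lambda>x. no_switch_run m n K x \<and> switch_run a K x) \<le> pr (\<lambda>x. G x \<and> switch_run a K x)"
  proof (rule pr_mono[of "{m..Suc n}"])
    show "depends_on {m..Suc n} (\<lambda>x. G x \<and> switch_run a K x)"
      using a assms by (intro depends_on_conj depr depends_on_mono[OF G]) auto
  qed (use assms imp_G in auto)
  also have "\<dots> \<le> pr G / 2 ^ K" by (rule pr_conj_switch_run[OF G assms(1) a(1)])
  also have "\<dots> \<le> pr (no_switch_run m n K) / 2 ^ K"
    using assms G_imp by (intro divide_right_mono pr_mono[OF depends_on_no_switch_run]) auto
  finally have "pr (no_switch_run m n K) - pr (no_switch_run m n K) / 2 ^ K \<le> pr (no_switch_run m (Suc n) K)"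
    using split by linarith
  then show ?thesis by (simp add: right_diff_distrib)
qed

text \<open>Iterates the one-term extension from right end 0, where no run fits. The exponent is
  therefore the right end \<open>n\<close>, cruder than the block length but sufficient.\<close>

lemma pr_no_switch_run:
  assumes "1 \<le> m" "1 \<le> K"
  shows "(1 - 1 / 2 ^ K) ^ n \<le> pr (no_switch_run m n K)"
proof (induction n)
  case 0
  have "no_switch_run m 0 K = (\<lambda>_. True)" using assms by (auto simp: no_switch_run_def fun_eq_iff)
  then show ?case by (simp add: pr_def prob_space)
next
  case (Suc n)
  have "(1 - 1 / 2 ^ K) ^ Suc n \<le> pr (no_switch_run m n K) * (1 - 1 / 2 ^ K :: real)"
    using mult_right_mono[OF Suc, of "1 - 1 / 2 ^ K"] by (simp add: mult.commute)
  also have "\<dots> \<le> pr (no_switch_run m (Suc n) K)" by (rule pr_no_switch_run_Suc[OF assms])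
  finally show ?case .
qed

text \<open>A union bound over the starts. Only the start is limited to \<open>n\<close>, so runs
  crossing the end of the prefix are covered.\<close>

lemma pr_run_starting_upto:
  "pr (\<lambda>x. \<exists>a. 1 \<le> a \<and> a \<le> n \<and> switch_run a K x) \<le> real n / 2 ^ K"
proof -
  have one: "pr (switch_run a K) \<le> 1 / 2 ^ K" if "1 \<le> a" for a
    using pr_conj_switch_run[of a a "\<lambda>_. True" K] that
    by (simp add: depends_on_def) (simp add: pr_def prob_space)
  have "{\<omega> \<in> space M. \<exists>a. 1 \<le> a \<and> a \<le> n \<and> switch_run a K (\<lambda>i. X i \<omega>)} =
      (\<Union>a\<in>{1..n}. {\<omega> \<in> space M. switch_run a K (\<lambda>i. X i \<omega>)})" by auto
  then have "pr (\<lambda>x. \<exists>a. 1 \<le> a \<and> a \<le> n \<and> switch_run a K x) =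
     prob (\<Union>a\<in>{1..n}. {\<omega> \<in> space M. switch_run a K (\<lambda>i. X i \<omega>)})" by (simp add: pr_def)
  also have "\<dots> \<le> (\<Sum>a\<in>{1..n}. pr (switch_run a K))"
    unfolding pr_def
    by (intro measure_UNION_le event_depends_on[OF depends_on_switch_run[OF order.refl]]) auto
  also have "\<dots> \<le> (\<Sum>a\<in>{1..n}. 1 / 2 ^ K)" by (intro sum_mono one) auto
  finally show ?thesis by simp
qed

lemma AE_bits: "AE \<omega> in M. \<forall>i\<ge>1. X i \<omega> \<in> {0, 1}"
proof -
  have "AE \<omega> in M. X i \<omega> \<in> {0, 1}" if "1 \<le> i" for i
  proof -
    have e: "depends_on {i} (\<lambda>x. x i = b)" for b by (rule depends_on_eq) auto
    have "pr (\<lambda>x. x i = 0 \<or> x i = 1) = pr (\<lambda>x. x i = 0) + pr (\<lambda>x. x i = 1)"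
      using that by (intro pr_disj[of "{i}"] e) auto
    also have "\<dots> = 1" using fair[OF that, of 0] fair[OF that, of 1] by (simp add: pr_def)
    finally have "prob {\<omega> \<in> space M. X i \<omega> = 0 \<or> X i \<omega> = 1} = 1" by (simp add: pr_def)
    moreover have "{\<omega> \<in> space M. X i \<omega> = 0 \<or> X i \<omega> = 1} \<in> events"
      using event_depends_on[OF depends_on_not[OF depends_on_conj[OF depends_on_not[OF e[of 0]] depends_on_not[OF e[of 1]]]]] that
      by simp
    ultimately show ?thesis by (subst (asm) prob_eq_1) auto
  qed
  then show ?thesis by (simp add: AE_all_countable)
qed

end

section \<open>The longest run on a fixed sample path\<close>

text \<open>Along a 0/1 sequence each of the \<open>n - 1\<close> positions contributes 0 or 1 to
  \<open>switch_count\<close>, so the total \<open>n - 1\<close> forces a switch at every position;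
  the first \<open>K\<close> of them would form a forbidden run.\<close>

lemma longest_switch_run_less:
  assumes \<omega>: "\<omega> \<in> space M" and N: "1 \<le> N" and bits: "\<And>i. 1 \<le> i \<Longrightarrow> X i \<omega> \<in> {0, 1}"
    and no_run: "\<And>a. 1 \<le> a \<Longrightarrow> a + K \<le> N \<Longrightarrow> \<not> switch_run a K (\<lambda>i. X i \<omega>)"
  shows "longest_switch_run M X N \<omega> < K"
  unfolding longest_switch_run_from_def
proof (subst Max_less_iff[OF finite_switch_runs switch_runs_nonempty[OF N \<omega>]], intro ballI)
  fix k assume "k \<in> {n - 1 | n. 1 \<le> n \<and> n \<le> N \<and> \<omega> \<in> switch_run_event M X N n 1}"
  then obtain n m where n: "k = n - 1" "1 \<le> n" "n \<le> N" and m: "1 \<le> m" "m \<le> 1 + N - n"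
    and sc: "switch_count X n m \<omega> = real n - 1"
    by (auto simp: switch_run_event_def)
  let ?s = "\<lambda>i. (1 - X (i - 1) \<omega>) * X i \<omega> + X (i - 1) \<omega> * (1 - X i \<omega>)"
  let ?J = "{m + 1..n + m - 1}"
  have s: "?s i = of_bool (switch_at (\<lambda>i. X i \<omega>) i)" if "i \<in> ?J" for i
  proof -
    have "1 \<le> i - 1" "1 \<le> i" using that m by auto
    then show ?thesis using bits[of i] bits[of "i - 1"] by (auto simp: switch_at_def)
  qed
  have "switch_count X n m \<omega> = (\<Sum>i\<in>?J. of_bool (switch_at (\<lambda>i. X i \<omega>) i))"
    unfolding switch_count_def sum.distrib[symmetric] by (intro sum.cong s) auto
  \<comment> \<open>The nonnegative deficits from 1 sum to zero, so each vanishes.\<close>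
  then have "(\<Sum>i\<in>?J. 1 - of_bool (switch_at (\<lambda>i. X i \<omega>) i)) = (0::real)"
    using sc n by (simp add: sum_subtractf of_nat_diff)
  then have "\<forall>i\<in>?J. 1 - of_bool (switch_at (\<lambda>i. X i \<omega>) i) = (0::real)"
    by (subst (asm) sum_nonneg_eq_0_iff) auto
  then have sw: "switch_at (\<lambda>i. X i \<omega>) i" if "i \<in> ?J" for i
    using that by (metis diff_zero of_bool_eq(1) zero_neq_one)
  show "k < K"
  proof (rule ccontr)
    assume "\<not> k < K"
    then have "switch_run m K (\<lambda>i. X i \<omega>)" using n unfolding switch_run_def by (auto intro!: sw)
    moreover have "m + K \<le> N" using m n \<open>\<not> k < K\<close> by linarith
    ultimately show False using no_run m by blast
  qed
qed

section \<open>Asymptotics of the sampling times and run lengths\<close>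

text \<open>With \<open>y\<close> the sampling time before rounding, \<open>log 2 y\<close> is K -
  \<epsilon>/2 + log ln K, while the triple logarithm is about log log K = log ln K + log log e. The
  iterated terms cancel, leaving \<epsilon>/2 of slack: \<epsilon>/4 pays for rounding and
  \<epsilon>/4 for the triple logarithm.\<close>

lemma run_length_le_bound:
  fixes \<epsilon> :: real
  assumes "\<epsilon> > 0"
  shows "\<forall>\<^sub>F K::nat in sequentially. real K \<le> log 2 (real (nat \<lfloor>2 powr (-\<epsilon>/2) * 2 ^ K * ln (real K)\<rfloor>))
     - log 2 (log 2 (log 2 (real (nat \<lfloor>2 powr (-\<epsilon>/2) * 2 ^ K * ln (real K)\<rfloor>)))) + log 2 (log 2 (exp 1)) + \<epsilon>"
proof -
  define c where "c = 2 powr (-\<epsilon>/2)"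
  have c: "0 < c" "c < 1" using assms by (auto simp: c_def powr_less_one)
  \<comment> \<open>17 leaves \<open>N\<close> at least 16 after rounding, so that all iterated
    logarithms have positive arguments.\<close>
  have big: "\<forall>\<^sub>F K::nat in sequentially. c * 2 ^ K * ln (real K) \<ge> 17"
    using c by real_asymp
  \<comment> \<open>The crude factor 2 costs only o(1) after two more logarithms.\<close>
  have up: "\<forall>\<^sub>F K::nat in sequentially. real K - \<epsilon>/2 + log 2 (ln (real K)) \<le> 2 * real K"
    by real_asymp
  have "(\<lambda>K::nat. log 2 (log 2 (2 * real K)) - log 2 (log 2 (real K))) \<longlonglongrightarrow> 0"
    by real_asymp
  then have up': "\<forall>\<^sub>F K::nat in sequentially. log 2 (log 2 (2 * real K)) - log 2 (log 2 (real K)) < \<epsilon>/4"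
    using assms by (intro order_tendstoD(2)[of _ 0]) auto
  have lo: "\<forall>\<^sub>F K::nat in sequentially. log 2 (c * 2 ^ K * ln (real K) - 1) \<ge> log 2 (c * 2 ^ K * ln (real K)) - \<epsilon>/4"
    using assms c by real_asymp
  show ?thesis
    using big up up' lo eventually_gt_at_top[of 1]
  proof eventually_elim
    case (elim K)
    define y where "y = c * 2 ^ K * ln (real K)"
    define N where "N = nat \<lfloor>y\<rfloor>"
    have y17: "y \<ge> 17" using elim unfolding y_def by simp
    have N: "y - 1 \<le> real N" "real N \<le> y" using y17 unfolding N_def by linarith+
    have lnK: "ln (real K) > 0" using elim by simp
    have logy: "log 2 y = real K - \<epsilon>/2 + log 2 (ln (real K))"
      using c lnK unfolding y_def by (simp add: log_mult log_nat_power c_def)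
    have l1: "log 2 (real N) \<ge> log 2 y - \<epsilon>/4"
    proof -
      have "log 2 (y - 1) \<le> log 2 (real N)" using N y17 by (subst log_le_cancel_iff) auto
      then show ?thesis using elim unfolding y_def by linarith
    qed
    have "log 2 16 \<le> log 2 (real N)" using N y17 by (subst log_le_cancel_iff) auto
    moreover have "log 2 (16::real) = 4" using log_nat_power[of 2 2 4] by simp
    ultimately have n4: "log 2 (real N) \<ge> 4" by simp
    have "log 2 (real N) \<le> log 2 y" using N y17 by (subst log_le_cancel_iff) auto
    then have "log 2 (log 2 (real N)) \<le> log 2 (log 2 y)" using n4 by (subst log_le_cancel_iff) auto
    moreover have "log 2 (log 2 (real N)) \<ge> log 2 4" using n4 by (subst log_le_cancel_iff) auto
    moreover have "log 2 (4::real) = 2" using log_nat_power[of 2 2 2] by simp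
    ultimately have l3: "log 2 (log 2 (log 2 (real N))) \<le> log 2 (log 2 (log 2 y))"
      by (subst log_le_cancel_iff) auto
    have y4: "4 \<le> log 2 y" using n4 \<open>log 2 (real N) \<le> log 2 y\<close> by linarith
    then have "log 2 (log 2 y) \<le> log 2 (2 * real K)"
      using elim logy by (subst log_le_cancel_iff) auto
    moreover have "0 < log 2 (log 2 y)" using y4 by (subst zero_less_log_cancel_iff) auto
    ultimately have "log 2 (log 2 (log 2 y)) \<le> log 2 (log 2 (2 * real K))"
      by (subst log_le_cancel_iff) auto
    then have l4: "log 2 (log 2 (log 2 y)) \<le> log 2 (log 2 (real K)) + \<epsilon>/4"
      using elim by linarith
    \<comment> \<open>This change of base is the source of the term log log e.\<close>
    have "log 2 (real K) = ln (real K) * log 2 (exp 1)" by (simp add: log_def)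
    then have "log 2 (log 2 (real K)) = log 2 (ln (real K)) + log 2 (log 2 (exp 1))"
      using lnK log_mult[of 2 "ln (real K)" "log 2 (exp 1)"] by simp
    then have "real K \<le> log 2 (real N) - log 2 (log 2 (log 2 (real N))) + log 2 (log 2 (exp 1)) + \<epsilon>"
      using l1 l3 l4 logy by linarith
    then show ?case by (simp add: N_def y_def c_def)
  qed
qed

text \<open>With t = 2^(-K) and N t \<le> c ln K, the inequality ln (1 - t) \<ge> -t / (1 - t)
  bounds the logarithm of the power below by -(c / (1 - t)) ln K. The gap between \<open>c\<close>
  and \<open>d\<close> absorbs the factor 1 / (1 - t).\<close>

lemma no_run_bound_ge_powr:
  fixes c d :: real
  assumes "0 < c" "c < d" "d < 1"
  shows "\<forall>\<^sub>F K::nat in sequentially. real K powr -d \<le> (1 - 1/2^K) ^ nat \<lfloor>c * 2 ^ K * ln (real K)\<rfloor>"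
proof -
  have *: "\<forall>\<^sub>F K::nat in sequentially. c / (1 - 1/2^K) \<le> d"
    using assms by real_asymp
  show ?thesis using * eventually_gt_at_top[of 1]
  proof eventually_elim
    case (elim K)
    define t :: real where "t = 1/2^K"
    have t: "0 < t" "t < 1" using elim unfolding t_def by auto
    define N where "N = nat \<lfloor>c * 2 ^ K * ln (real K)\<rfloor>"
    have lnK: "ln (real K) > 0" using elim by simp
    have "real N \<le> c * 2 ^ K * ln (real K)" unfolding N_def using assms lnK by simp
    then have "real N * t \<le> c * ln (real K)" unfolding t_def by (simp add: field_simps)
    then have "real N * (t / (1 - t)) \<le> c * ln (real K) / (1 - t)"
      using t by (simp add: divide_right_mono)
    also have "\<dots> = (c / (1 - t)) * ln (real K)" by simp
    also have "\<dots> \<le> d * ln (real K)" using elim lnK unfolding t_def by (intro mult_right_mono) auto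
    finally have a: "real N * (t / (1 - t)) \<le> d * ln (real K)" .
    have "ln (1 / (1 - t)) \<le> 1 / (1 - t) - 1" using t by (intro ln_le_minus_one) auto
    also have "\<dots> = t / (1 - t)" using t by (simp add: field_simps)
    finally have "- (t / (1 - t)) \<le> ln (1 - t)" using t by (simp add: ln_div)
    then have "real N * - (t / (1 - t)) \<le> real N * ln (1 - t)" by (intro mult_left_mono) auto
    then have "- d * ln (real K) \<le> real N * ln (1 - t)" using a by simp
    then have "exp (- d * ln (real K)) \<le> exp (real N * ln (1 - t))" by simp
    also have "exp (real N * ln (1 - t)) = (1 - t) ^ N" using t by (simp add: exp_of_nat_mult)
    finally show ?case using elim by (simp add: powr_def t_def N_def)
  qed
qed

text \<open>Two demands meet here: gaps of about \<open>3 * log 2 j\<close> make the ratio of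
  successive powers of 2 of order j^(-3), while the growth stays below j^(1/d) for every d <
  1.\<close>

definition level :: "nat \<Rightarrow> nat" where "level j = nat \<lceil>3 * real j * log 2 (real j)\<rceil>"

lemma level_bounds: "3 * real j * log 2 (real j) \<le> real (level j)" "real (level j) \<le> 3 * real j * log 2 (real j) + 1"
proof -
  have "3 * real j * log 2 (real j) \<ge> 0" by (cases "j = 0") auto
  then show "3 * real j * log 2 (real j) \<le> real (level j)" "real (level j) \<le> 3 * real j * log 2 (real j) + 1"
    unfolding level_def by linarith+
qed

lemma mono_level: "mono level"
proof (rule monoI)
  fix i j :: nat assume "i \<le> j"
  then have "3 * real i * log 2 (real i) \<le> 3 * real j * log 2 (real j)"
    by (cases "i = 0"; cases "j = 0") (auto intro!: mult_mono)
  then show "level i \<le> level j" unfolding level_def by (intro nat_mono ceiling_mono)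
qed

text \<open>Replacing log (j - 1) by log j leaves a difference of one log j, tripled by the factor
  3; the 1 is lost to rounding up \<open>level (j - 1)\<close>.\<close>

lemma level_gap:
  assumes j: "j > 1"
  shows "real (level (j - 1)) + 3 * log 2 (real j) - 1 \<le> real (level j)"
proof -
  have "real (j-1) * log 2 (real (j-1)) \<le> real (j-1) * log 2 (real j)"
    using j by (intro mult_left_mono) auto
  also have "\<dots> = real j * log 2 (real j) - log 2 (real j)" using j by (simp add: of_nat_diff algebra_simps)
  finally show ?thesis using level_bounds[of j] level_bounds[of "j-1"] by linarith
qed

lemma level_powr_ge:
  assumes "0 < d" "d < 1"
  shows "\<forall>\<^sub>F j in sequentially. 1 / real j \<le> real (level j) powr -d"
proof -
  have "\<forall>\<^sub>F j::nat in sequentially. 1 / real j \<le> (3 * real j * log 2 (real j) + 1) powr -d"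
    using assms by real_asymp
  then show ?thesis using eventually_gt_at_top[of 1]
  proof eventually_elim
    case (elim j)
    have "0 < 3 * real j * log 2 (real j)" using elim by simp
    then have "0 < real (level j)" using level_bounds(1)[of j] by linarith
    then have "(3 * real j * log 2 (real j) + 1) powr -d \<le> real (level j) powr -d"
      using level_bounds(2)[of j] assms by (intro powr_mono2') auto
    then show ?case using elim by linarith
  qed
qed

text \<open>The gap of levels yields 2 / j^3, and the remaining factor ln a is at most j / 2 because
  the levels grow only like j log j.\<close>

lemma prefix_run_bound_le:
  assumes "0 < c" "c < 1"
  shows "\<forall>\<^sub>F j in sequentially. real (nat \<lfloor>c * 2 ^ level (j - 1) * ln (real (level (j - 1)))\<rfloor>) / 2 ^ level j \<le> 1 / real j ^ 2"
proof -
  have "\<forall>\<^sub>F j::nat in sequentially. 2 * ln (3 * real j * log 2 (real j) + 1) \<le> real j"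
    by real_asymp
  then show ?thesis using eventually_gt_at_top[of 2]
  proof eventually_elim
    case (elim j)
    define a where "a = level (j - 1)"
    have "3 * real (j-1) * log 2 (real (j-1)) > 0" using elim by simp
    then have a0: "0 < real a" using level_bounds(1)[of "j-1"] unfolding a_def by linarith
    have "real a \<le> real (level j)" using mono_level by (auto simp: a_def mono_def)
    also have "\<dots> \<le> 3 * real j * log 2 (real j) + 1" by (rule level_bounds)
    finally have la: "2 * ln (real a) \<le> real j"
      using elim a0 by (smt (verit) ln_le_cancel_iff)
    have lna: "ln (real a) \<ge> 0" using a0 by (cases a) auto
    have "2 powr (real a - real (level j)) \<le> 2 powr (1 - 3 * log 2 (real j))"
      using level_gap[of j] elim unfolding a_def by (intro powr_mono) auto
    also have "\<dots> = 2 / (2 powr log 2 (real j)) ^ 3"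
      by (simp add: powr_diff powr_powr mult.commute flip: powr_numeral)
    also have "\<dots> = 2 / real j ^ 3" using elim by simp
    finally have g: "2 ^ a / 2 ^ level j \<le> 2 / real j ^ 3" by (simp add: powr_diff powr_realpow)
    have "real (nat \<lfloor>c * 2 ^ a * ln (real a)\<rfloor>) \<le> c * 2 ^ a * ln (real a)"
      using assms lna by simp
    also have "\<dots> \<le> 1 * 2 ^ a * ln (real a)" using assms lna by (intro mult_right_mono) auto
    finally have "real (nat \<lfloor>c * 2 ^ a * ln (real a)\<rfloor>) / 2 ^ level j \<le> (2 ^ a / 2 ^ level j) * ln (real a)"
      by (simp add: divide_right_mono)
    also have "\<dots> \<le> 2 / real j ^ 3 * ln (real a)" using g lna by (intro mult_right_mono) auto
    also have "\<dots> = (2 * ln (real a)) / real j ^ 3" by simp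
    also have "\<dots> \<le> real j / real j ^ 3" using la by (intro divide_right_mono) auto
    also have "\<dots> = 1 / real j ^ 2" using elim by (simp add: power2_eq_square power3_eq_cube)
    finally show ?case by (simp add: a_def)
  qed
qed

lemma filterlim_level: "filterlim level at_top sequentially"
proof (rule filterlim_at_top_mono[OF filterlim_ident])
  have "\<forall>\<^sub>F j::nat in sequentially. real j \<le> 3 * real j * log 2 (real j)" by real_asymp
  then show "\<forall>\<^sub>F j in sequentially. j \<le> level j"
    using level_bounds(1) by (elim eventually_mono) (use of_nat_le_iff order_trans in blast)
qed

section \<open>The almost sure statement\<close>

context fair_bits
begin

lemma AE_switch_runs_short:
  assumes "\<epsilon> > 0"
  shows "AE \<omega> in M. \<exists>\<^sub>\<infinity>N. 3 \<le> N \<and> int (longest_switch_run M X N \<omega>) <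
      \<lfloor>log 2 (real N) - log 2 (log 2 (log 2 (real N))) + log 2 (log 2 (exp 1)) + \<epsilon>\<rfloor>"
proof -
  \<comment> \<open>\<open>d\<close> may be anything strictly between \<open>c\<close> and 1;
    halving the exponent gives such a value.\<close>
  define c d where "c = 2 powr (-\<epsilon>/2)" and "d = 2 powr (-\<epsilon>/4)"
  have d: "0 < d" and cd: "0 < c" "c < d" "d < 1" using assms by (auto simp: c_def d_def powr_less_one)
  define F where "F K = nat \<lfloor>c * 2 ^ K * ln (real K)\<rfloor>" for K :: nat
  define n where "n j = F (level j)" for j
  have "mono F"
  proof (rule monoI)
    fix K L :: nat assume "K \<le> L"
    then have "c * 2 ^ K * ln (real K) \<le> c * 2 ^ L * ln (real L)"
      \<comment> \<open>The convention \<open>ln 0 = 0\<close> covers \<open>K = 0\<close>.\<close>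
      using cd by (cases "K = 0"; cases "L = 0") (auto intro!: mult_mono)
    then show "F K \<le> F L" unfolding F_def by (intro nat_mono floor_mono)
  qed
  then have n_mono: "i \<le> j \<Longrightarrow> n i \<le> n j" for i j
    using mono_level by (simp add: n_def mono_def)
  have F_ge: "\<forall>\<^sub>F K in sequentially. K \<le> F K"
  proof -
    have "\<forall>\<^sub>F K::nat in sequentially. real K \<le> c * 2 ^ K * ln (real K)"
      using cd by real_asymp
    then show ?thesis by (elim eventually_mono) (simp add: F_def le_nat_iff le_floor_iff)
  qed
  have "filterlim F at_top sequentially"
    by (rule filterlim_at_top_mono[OF filterlim_ident F_ge])
  then have n_lim: "filterlim n at_top sequentially"
    unfolding n_def[abs_def] by (rule filterlim_compose[OF _ filterlim_level])
  define Q where "Q j = no_switch_run (n (j - 1) + 1) (n j) (level j)" for j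
  \<comment> \<open>Runs straddling the boundary belong to \<open>R\<close>, so \<open>Q j\<close>
    together with the failure of \<open>R j\<close> excludes every run within the first
    \<open>n j\<close> terms. At \<open>j = 0\<close> truncated subtraction makes the block
    empty.\<close>
  define R where "R j = (\<lambda>x. \<exists>a. 1 \<le> a \<and> a \<le> n (j - 1) \<and> switch_run a (level j) x)" for j
  have Q: "depends_on {n (j - 1) + 1..n j} (Q j)" for j
    unfolding Q_def by (rule depends_on_no_switch_run)
  have disj: "disjoint_family (\<lambda>j. {n (j - 1) + 1..n j})"
  proof -
    have "{n (i - 1) + 1..n i} \<inter> {n (j - 1) + 1..n j} = {}" if "i < j" for i j
    proof -
      have "n i \<le> n (j - 1)" using that by (intro n_mono) linarith
      then show ?thesis by auto
    qed
    then show ?thesis unfolding disjoint_family_on_def by (metis inf_commute nat_neq_iff)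
  qed
  have Q_inf: "AE \<omega> in M. infinite {j. Q j (\<lambda>i. X i \<omega>)}"
  proof (rule borel_cantelli2_AE)
    show "indep_events (\<lambda>j. {\<omega> \<in> space M. \<not> Q j (\<lambda>i. X i \<omega>)}) UNIV"
      by (rule indep_events_depends_on[OF depends_on_not[OF Q] _ disj]) auto
    \<comment> \<open>The harmonic series is the divergent minorant.\<close>
    have "\<forall>\<^sub>F j in sequentially. norm (1 / real j) \<le> pr (Q j)"
      using level_powr_ge[OF d cd(3)]
        eventually_compose_filterlim[OF no_run_bound_ge_powr[OF cd] filterlim_level]
        filterlim_level[unfolded filterlim_at_top, rule_format, of 1]
    proof eventually_elim
      case (elim j)
      have "1 / real j \<le> (1 - 1 / 2 ^ level j) ^ n j" using elim by (simp add: n_def F_def)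
      also have "\<dots> \<le> pr (Q j)" unfolding Q_def using elim by (intro pr_no_switch_run) auto
      finally show ?case by simp
    qed
    then have "summable (\<lambda>j. 1 / real j)" if "summable (\<lambda>j. pr (Q j))"
      using that by (rule summable_comparison_test_ev)
    then show "\<not> summable (\<lambda>j. prob {\<omega> \<in> space M. Q j (\<lambda>i. X i \<omega>)})"
      using not_summable_harmonic[where 'a=real] unfolding pr_def inverse_eq_divide by blast
  qed
  have R_fin: "AE \<omega> in M. \<forall>\<^sub>F j in sequentially. \<omega> \<in> space M - {\<omega> \<in> space M. R j (\<lambda>i. X i \<omega>)}"
  proof (rule borel_cantelli_AE1)
    fix j
    have "{\<omega> \<in> space M. R j (\<lambda>i. X i \<omega>)} =
        (\<Union>a\<in>{1..n (j - 1)}. {\<omega> \<in> space M. switch_run a (level j) (\<lambda>i. X i \<omega>)})"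
      by (auto simp: R_def)
    also have "\<dots> \<in> events"
      by (intro sets.finite_UN event_depends_on[OF depends_on_switch_run[OF order.refl]]) auto
    finally show "{\<omega> \<in> space M. R j (\<lambda>i. X i \<omega>)} \<in> events" .
    show "emeasure M {\<omega> \<in> space M. R j (\<lambda>i. X i \<omega>)} < \<infinity>" by (simp add: less_top[symmetric])
  next
    have "c < 1" using cd by simp
    have "\<forall>\<^sub>F j in sequentially. norm (pr (R j)) \<le> 1 / real j ^ 2"
      using prefix_run_bound_le[OF cd(1) \<open>c < 1\<close>]
    proof eventually_elim
      case (elim j)
      have "pr (R j) \<le> real (n (j - 1)) / 2 ^ level j" unfolding R_def by (rule pr_run_starting_upto)
      also have "\<dots> \<le> 1 / real j ^ 2" using elim by (simp add: n_def F_def)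
      finally show ?case by (simp add: pr_def)
    qed
    moreover have "summable (\<lambda>j. 1 / real j ^ 2)"
      using inverse_power_summable[of 2, where 'a=real] by (simp add: inverse_eq_divide)
    ultimately show "summable (\<lambda>j. prob {\<omega> \<in> space M. R j (\<lambda>i. X i \<omega>)})"
      unfolding pr_def by (rule summable_comparison_test_ev)
  qed
  have level_le: "\<forall>\<^sub>F j in sequentially. real (level j) \<le>
      log 2 (real (n j)) - log 2 (log 2 (log 2 (real (n j)))) + log 2 (log 2 (exp 1)) + \<epsilon>"
    using eventually_compose_filterlim[OF run_length_le_bound[OF assms] filterlim_level]
    by (simp add: n_def F_def c_def)
  show ?thesis
    using Q_inf R_fin AE_bits AE_space
  proof eventually_elim
    case (elim \<omega>)
    show "\<exists>\<^sub>\<infinity>N. 3 \<le> N \<and> int (longest_switch_run M X N \<omega>) <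
      \<lfloor>log 2 (real N) - log 2 (log 2 (log 2 (real N))) + log 2 (log 2 (exp 1)) + \<epsilon>\<rfloor>"
      unfolding INFM_nat_le
    proof
      fix m
      \<comment> \<open>3 serves the lower bound on \<open>N\<close>; the arbitrary \<open>m\<close>
        yields infinitely many \<open>N\<close>.\<close>
      have "\<forall>\<^sub>F j in sequentially. max 3 m \<le> n j"
        using n_lim unfolding filterlim_at_top by blast
      with elim(2) level_le
      have "\<forall>\<^sub>F j in sequentially. \<not> R j (\<lambda>i. X i \<omega>) \<and> max 3 m \<le> n j \<and> real (level j) \<le>
          log 2 (real (n j)) - log 2 (log 2 (log 2 (real (n j)))) + log 2 (log 2 (exp 1)) + \<epsilon>"
        by eventually_elim auto
      moreover have "\<exists>\<^sub>F j in sequentially. Q j (\<lambda>i. X i \<omega>)"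
        using elim(1) by (simp add: frequently_cofinite flip: cofinite_eq_sequentially)
      ultimately obtain j where j: "Q j (\<lambda>i. X i \<omega>)" "\<not> R j (\<lambda>i. X i \<omega>)" "max 3 m \<le> n j"
          "real (level j) \<le> log 2 (real (n j)) - log 2 (log 2 (log 2 (real (n j))))
            + log 2 (log 2 (exp 1)) + \<epsilon>"
        using frequently_ex[OF frequently_eventually_conj] by blast
      have "\<not> switch_run a (level j) (\<lambda>i. X i \<omega>)" if "1 \<le> a" "a + level j \<le> n j" for a
        using j that by (cases "a \<le> n (j - 1)") (auto simp: Q_def R_def no_switch_run_def)
      then have "longest_switch_run M X (n j) \<omega> < level j"
        using elim(3,4) j by (intro longest_switch_run_less) auto
      moreover have "int (level j) \<le> \<lfloor>log 2 (real (n j)) - log 2 (log 2 (log 2 (real (n j))))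
            + log 2 (log 2 (exp 1)) + \<epsilon>\<rfloor>"
        using j by (simp add: le_floor_iff)
      ultimately show "\<exists>N\<ge>m. 3 \<le> N \<and> int (longest_switch_run M X N \<omega>) <
          \<lfloor>log 2 (real N) - log 2 (log 2 (log 2 (real N))) + log 2 (log 2 (exp 1)) + \<epsilon>\<rfloor>"
        using j by (intro exI[of _ "n j"]) auto
    qed
  qed
qed

end

theorem theorem3p3:
  fixes M :: "'a measure" and X :: "nat \<Rightarrow> 'a \<Rightarrow> real" and \<epsilon> :: real
  assumes "prob_space M"
    and "prob_space.indep_vars M (\<lambda>_. borel) X {1..}"
    and "\<And>i. 1 \<le> i \<Longrightarrow> distr M borel (X i) = distr M borel (X 1)"
    and "measure M {\<omega> \<in> space M. X 1 \<omega> = 0} = 1 / 2"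
    and "measure M {\<omega> \<in> space M. X 1 \<omega> = 1} = 1 / 2"
    and "\<epsilon> > 0"
  shows "AE \<omega> in M. \<exists>Ns :: nat \<Rightarrow> nat. inj_on Ns {1..} \<and>
           (\<forall>i\<ge>1. 3 \<le> Ns i \<and>
              int (longest_switch_run M X (Ns i) \<omega>) <
                \<lfloor>log 2 (real (Ns i)) - log 2 (log 2 (log 2 (real (Ns i))))
                 + log 2 (log 2 (exp 1)) + \<epsilon>\<rfloor>)"
proof -
  interpret prob_space M by fact
  have rv: "X i \<in> borel_measurable M" if "1 \<le> i" for i
    using assms(2) that by (auto simp: indep_vars_def)
  interpret fair_bits M X
  proof
    fix i :: nat and b :: real
    assume i: "1 \<le> i" and b: "b \<in> {0, 1}"
    have pre: "{\<omega> \<in> space M. X k \<omega> = b} = X k -` {b} \<inter> space M" for k by auto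
    \<comment> \<open>Equality of distributions carries fairness over from
      \<open>X 1\<close>.\<close>
    have "prob {\<omega> \<in> space M. X i \<omega> = b} = measure (distr M borel (X i)) {b}"
      using rv[OF i] by (simp add: measure_distr pre)
    also have "\<dots> = prob {\<omega> \<in> space M. X 1 \<omega> = b}"
      using rv[of 1] by (simp add: assms(3)[OF i] measure_distr pre)
    also have "\<dots> = 1 / 2" using b assms(4,5) by auto
    finally show "prob {\<omega> \<in> space M. X i \<omega> = b} = 1 / 2" .
  qed (fact assms(2))
  show ?thesis
    using AE_switch_runs_short[OF assms(6)]
  proof (rule AE_mp, intro AE_I2 impI)
    fix \<omega>
    let ?P = "\<lambda>N. 3 \<le> N \<and> int (longest_switch_run M X N \<omega>) <
      \<lfloor>log 2 (real N) - log 2 (log 2 (log 2 (real N))) + log 2 (log 2 (exp 1)) + \<epsilon>\<rfloor>"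
    assume "\<exists>\<^sub>\<infinity>N. ?P N"
    then have "infinite {N. ?P N}" by (simp add: INFM_iff_infinite)
    \<comment> \<open>A strictly increasing enumeration supplies the distinctness of the
      \<open>Ns i\<close>.\<close>
    then obtain Ns :: "nat \<Rightarrow> nat" where "strict_mono Ns" "\<forall>i. Ns i \<in> {N. ?P N}"
      using infinite_enumerate by blast
    then show "\<exists>Ns :: nat \<Rightarrow> nat. inj_on Ns {1..} \<and> (\<forall>i\<ge>1. 3 \<le> Ns i \<and>
        int (longest_switch_run M X (Ns i) \<omega>) <
          \<lfloor>log 2 (real (Ns i)) - log 2 (log 2 (log 2 (real (Ns i))))
            + log 2 (log 2 (exp 1)) + \<epsilon>\<rfloor>)"
      by (intro exI[of _ Ns]) (auto intro: inj_on_subset[OF strict_mono_imp_inj_on])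
  qed
qed

end
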